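(* Let $A\in \mathbb{M}_2(\mathbb{R})$. If $A=cI$ for some $c\in\mathbb{R}\setminus\{0\}$ (where $I$ is the $2\times 2$ identity matrix), then the operator $\mathcal{E}^1_A$ is unbounded on $L^p(\mathbb{R}^3)$ for every $0<p<\infty$. Furthermore, if $A=\begin{pmatrix} c&0\\0&c\cdot 2^{2a}\end{pmatrix}$ for some $a\in\mathbb{Z}$ and $c\in\mathbb{R}\setminus\{0\}$, then the operator $\mathcal{E}^2_A$ is unbounded on $L^p(\mathbb{R}^3)$ for every $0<p<\infty$.
   Context: $\mathbb{M}_2(\mathbb{R})$ is the space of real $2\times2$ matrices and $d\sigma$ is the canonical Lebesgue (arc length) measure on the unit circle $S^1\subset\mathbb{R}^2$. For $A\in\mathbb{M}_2(\mathbb{R})$, $t_1,t_2>0$, $(x,x_3)\in\mathbb{R}^2\times\mathbb{R}$ and $f\in\mathcal{S}(\mathbb{R}^3)$ (Schwartz functions), set $$E^A_{t_1,t_2}f(x,x_3)=\int_{S^1} f\Big(x-(t_1y_1,t_2y_2),\,x_3-x^tA\begin{pmatrix}t_1y_1\\t_2y_2\end{pmatrix}\Big)\,d\sigma(y).$$ The lacunary circular and lacunary elliptic maximal operators are $$\mathcal{E}^1_Af(x,x_3)=\sup_{k\in\mathbb{Z}}|E^A_{2^k,2^k}f(x,x_3)|,\qquad \mathcal{E}^2_Af(x,x_3)=\sup_{k_1,k_2\in\mathbb{Z}}|E^A_{2^{k_1},2^{k_2}}f(x,x_3)|.$$ An operator $T$ is bounded on $L^p(\mathbb{R}^3)$ if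 there is a constant $C$ with $\|Tf\|_{L^p(\mathbb{R}^3)}\le C\|f\|_{L^p(\mathbb{R}^3)}$ for all $f\in\mathcal{S}(\mathbb{R}^3)$; it is unbounded if no such $C$ exists. *)

theory Defs
  imports "HOL-Analysis.Analysis"
begin

fun iter_partial :: "'a::euclidean_space list \<Rightarrow> ('a \<Rightarrow> complex) \<Rightarrow> 'a \<Rightarrow> complex" where
  "iter_partial [] f = f"
| "iter_partial (b # bs) f = (\<lambda>x. frechet_derivative (iter_partial bs f) (at x) b)"

text \<open>The list \<^term>\<open>bs\<close> of coordinate directions plays the role of a multi-index.
  Differentiability of all iterated partial derivatives is smoothness, and ensures that
  \<^const>\<open>frechet_derivative\<close> is never applied outside its domain.\<close>

definition schwartz :: "('a::euclidean_space \<Rightarrow> complex) set" where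
  "schwartz = {f. \<forall>bs. set bs \<subseteq> Basis \<longrightarrow>
     (\<forall>x. iter_partial bs f differentiable (at x)) \<and>
     (\<forall>N::nat. \<exists>C::real. \<forall>x. (1 + norm x) ^ N * norm (iter_partial bs f x) \<le> C)}"

definition ennreal_powr :: "ennreal \<Rightarrow> real \<Rightarrow> ennreal" where
  "ennreal_powr u p = (if u = \<infinity> then \<infinity> else ennreal (enn2real u powr p))"

text \<open>Meant for \<open>0 < p < \<infinity>\<close>; only a quasi-norm when \<open>p < 1\<close>.  Functions take values in
  \<open>[0, \<infinity>]\<close>, so that suprema need no finiteness side conditions.\<close>

definition Lp_norm :: "real \<Rightarrow> ('a::euclidean_space \<Rightarrow> ennreal) \<Rightarrow> ennreal" where
  "Lp_norm p g = ennreal_powr (\<integral>\<^sup>+ x. ennreal_powr (g x) p \<partial>lborel) (1 / p)"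

definition bounded_on_Lp ::
    "real \<Rightarrow> (('a::euclidean_space \<Rightarrow> complex) \<Rightarrow> 'a \<Rightarrow> ennreal) \<Rightarrow> bool" where
  "bounded_on_Lp p T \<longleftrightarrow>
     (\<exists>C::real. C \<ge> 0 \<and>
        (\<forall>f\<in>schwartz. Lp_norm p (T f) \<le> ennreal C * Lp_norm p (\<lambda>x. ennreal (norm (f x)))))"

text \<open>Arc length on the unit circle, as the image of Lebesgue measure under the unit-speed
  parametrisation.\<close>

definition circle_measure :: "(real^2) measure" where
  "circle_measure =
     distr (restrict_space lborel {0..<2 * pi}) borel (\<lambda>\<theta>. vector [cos \<theta>, sin \<theta>])"

text \<open>The space \<open>\<real>\<^sup>3\<close> is \<open>\<real>\<^sup>2 \<times> \<real>\<close>, with the Euclidean norm and Lebesgue measure of the product.\<close>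

definition elliptic_avg ::
    "real^2^2 \<Rightarrow> real \<Rightarrow> real \<Rightarrow> ((real^2) \<times> real \<Rightarrow> complex) \<Rightarrow> (real^2) \<times> real \<Rightarrow> complex" where
  "elliptic_avg A t1 t2 f = (\<lambda>(x, x3).
     LINT y|circle_measure.
       (let z = vector [t1 * y $ 1, t2 * y $ 2] in f (x - z, x3 - x \<bullet> (A *v z))))"

definition lacunary_circular ::
    "real^2^2 \<Rightarrow> ((real^2) \<times> real \<Rightarrow> complex) \<Rightarrow> (real^2) \<times> real \<Rightarrow> ennreal" where
  "lacunary_circular A f v =
     (SUP k::int. ennreal (norm (elliptic_avg A (2 powi k) (2 powi k) f v)))"

definition lacunary_elliptic ::
    "real^2^2 \<Rightarrow> ((real^2) \<times> real \<Rightarrow> complex) \<Rightarrow> (real^2) \<times> real \<Rightarrow> ennreal" where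
  "lacunary_elliptic A f v =
     (SUP k1::int. SUP k2::int. ennreal (norm (elliptic_avg A (2 powi k1) (2 powi k2) f v)))"

end

theory Submission
  imports Defs "HOL-Probability.Distributions"
begin

text \<open>
  Write \<open>q(w) = w \<bullet> A w\<close>, a diagonal quadratic form. Polarisation turns the twist in the third
  variable into a mere translation along the paraboloids \<open>r = q(w) / 2 + const\<close>: if
  \<open>(w, r) = (x - z, x\<^sub>3 - x \<bullet> A z)\<close> then
  \<open>r - q(w) / 2 = (x\<^sub>3 - q(x) / 2) - q(z) / 2\<close>.
  For \<open>A = c I\<close> the number \<open>q(z)\<close> is the constant \<open>c t\<^sup>2\<close> on the circle of radius \<open>t\<close>. For
  \<open>A = diag(c, c 4\<^sup>a)\<close> it is the constant \<open>c 4\<^sup>k\<close> on the ellipse with semi-axes \<open>2\<^sup>k\<close> and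
  \<open>2\<^bsup>k - a\<^esup>\<close>, which is one of the lacunary ellipses exactly because \<open>a\<close> is an integer. In the sheared
  height \<open>s = x\<^sub>3 - q(x) / 2\<close> the average at scale \<open>k\<close> is therefore a planar average followed by the
  rigid shift by \<open>c 4\<^sup>k / 2\<close>; the average does not smooth in \<open>s\<close> at all.

  Test on \<open>f(w, r) = exp (- |w|\<^sup>2 - ((r - q(w) / 2) / \<delta>)\<^sup>2)\<close>, a function living at sheared heights of
  size \<open>\<delta>\<close>. The scales \<open>k = -1, \<dots>, -N\<close> keep the planar part of the average bounded below on the unit
  disc, and they carry the bump to \<open>N\<close> heights which, for \<open>\<delta> = |c| 4\<^bsup>-N\<^esup>\<close>, are more than \<open>\<delta>\<close> apart.
  So the maximal function is bounded below on a set of measure comparable to \<open>N \<delta>\<close>, whereas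
  \<open>\<parallel>f\<parallel>\<^sub>p\<^sup>p\<close> is a constant multiple of \<open>\<delta>\<close>. As \<open>N\<close> is arbitrary, no \<open>L\<^sup>p\<close> bound can hold.

  Shift and separation enter in \<open>elliptic_avg_paraboloid_gaussian_ge\<close> and
  \<open>emeasure_lacunary_intervals\<close>; both operators are covered by
  \<open>not_bounded_on_Lp_of_elliptic_averages\<close>, the circular one being \<open>a = 0\<close>. A Gaussian is used
  rather than a compactly supported bump because all its derivatives are polynomial multiples of it,
  which gives membership in the Schwartz space by induction.
\<close>

section \<open>Gaussians of polynomial exponent are Schwartz functions\<close>

lemma real_polynomial_function_has_derivative:
  fixes P :: "'a::real_normed_vector \<Rightarrow> real"
  assumes "real_polynomial_function P"
  shows "\<exists>D. (\<forall>x. (P has_derivative D x) (at x)) \<and> (\<forall>b. real_polynomial_function (\<lambda>x. D x b))"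
  using assms
proof induction
  case (linear f)
  then show ?case
    by (intro exI[of _ "\<lambda>x. f"]) (auto intro: bounded_linear_imp_has_derivative)
next
  case (const c)
  show ?case by (intro exI[of _ "\<lambda>x h. 0"]) auto
next
  case (add f g)
  then obtain D E where "\<forall>x. (f has_derivative D x) (at x)" "\<forall>b. real_polynomial_function (\<lambda>x. D x b)"
    "\<forall>x. (g has_derivative E x) (at x)" "\<forall>b. real_polynomial_function (\<lambda>x. E x b)"
    by blast
  then show ?case
    by (intro exI[of _ "\<lambda>x h. D x h + E x h"]) (auto intro: has_derivative_add)
next
  case (mult f g)
  then obtain D E where "\<forall>x. (f has_derivative D x) (at x)" "\<forall>b. real_polynomial_function (\<lambda>x. D x b)"
    "\<forall>x. (g has_derivative E x) (at x)" "\<forall>b. real_polynomial_function (\<lambda>x. E x b)"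
    by blast
  with mult.hyps show ?case
    by (intro exI[of _ "\<lambda>x h. f x * E x h + D x h * g x"])
       (auto intro!: has_derivative_mult real_polynomial_function.intros(3,4))
qed

lemma real_polynomial_function_growth:
  fixes P :: "'a::real_normed_vector \<Rightarrow> real"
  assumes "real_polynomial_function P"
  shows "\<exists>C M. C \<ge> 0 \<and> (\<forall>x. \<bar>P x\<bar> \<le> C * (1 + norm x) ^ M)"
  using assms
proof induction
  case (linear f)
  then obtain K where K: "K > 0" "\<And>x. norm (f x) \<le> norm x * K"
    using bounded_linear.pos_bounded by blast
  have "\<bar>f x\<bar> \<le> K * (1 + norm x) ^ 1" for x
    using K(2)[of x] K(1) by (simp add: algebra_simps)
  with K(1) show ?case using less_imp_le by blast
next
  case (const c)
  have "\<bar>c\<bar> \<le> \<bar>c\<bar> * (1 + norm x) ^ 0" for x :: 'a by simp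
  then show ?case using abs_ge_zero by blast
next
  case (add f g)
  then obtain C M C' M' where f: "C \<ge> 0" "\<And>x. \<bar>f x\<bar> \<le> C * (1 + norm x) ^ M"
    and g: "C' \<ge> 0" "\<And>x. \<bar>g x\<bar> \<le> C' * (1 + norm x) ^ M'"
    by blast
  have "\<bar>f x + g x\<bar> \<le> (C + C') * (1 + norm x) ^ (M + M')" for x
  proof -
    have "C * (1 + norm x) ^ M \<le> C * (1 + norm x) ^ (M + M')"
         "C' * (1 + norm x) ^ M' \<le> C' * (1 + norm x) ^ (M + M')"
      by (intro mult_left_mono f g power_increasing; simp)+
    with f(2)[of x] g(2)[of x] show ?thesis by (simp add: distrib_right)
  qed
  with f(1) g(1) show ?case by (meson add_nonneg_nonneg)
next
  case (mult f g)
  then obtain C M C' M' where f: "C \<ge> 0" "\<And>x. \<bar>f x\<bar> \<le> C * (1 + norm x) ^ M"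
    and g: "C' \<ge> 0" "\<And>x. \<bar>g x\<bar> \<le> C' * (1 + norm x) ^ M'"
    by blast
  have "\<bar>f x * g x\<bar> \<le> (C * C') * (1 + norm x) ^ (M + M')" for x
    using mult_mono[OF f(2)[of x] g(2)[of x]] f(1)
    by (simp add: abs_mult power_add mult_ac)
  with f(1) g(1) show ?case by (meson mult_nonneg_nonneg)
qed

lemma has_derivative_times_exp_minus:
  fixes P Q :: "'a::real_normed_vector \<Rightarrow> real"
  assumes P: "(P has_derivative D) (at x)" and Q: "(Q has_derivative E) (at x)"
  shows "((\<lambda>x. complex_of_real (P x * exp (- Q x))) has_derivative
          (\<lambda>h. of_real ((D h - P x * E h) * exp (- Q x)))) (at x)"
proof (rule has_derivative_of_real)
  have "((\<lambda>x. exp (- Q x)) has_derivative (\<lambda>h. - E h * exp (- Q x))) (at x)"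
    by (rule has_derivative_exp[OF has_derivative_minus[OF Q]])
  from has_derivative_mult[OF P this]
  show "((\<lambda>x. P x * exp (- Q x)) has_derivative (\<lambda>h. (D h - P x * E h) * exp (- Q x))) (at x)"
    by (simp add: algebra_simps)
qed

text \<open>The class of products of a polynomial with \<open>exp (- Q)\<close> is closed under every partial
  derivative, so an induction over the multi-index never leaves it.\<close>

lemma iter_partial_exp_polynomial:
  fixes Q :: "'a::euclidean_space \<Rightarrow> real"
  assumes "real_polynomial_function Q"
  shows "\<exists>P. real_polynomial_function P \<and>
           iter_partial bs (\<lambda>x. complex_of_real (exp (- Q x))) = (\<lambda>x. of_real (P x * exp (- Q x)))"
proof (induction bs)
  case Nil
  show ?case by (intro exI[of _ "\<lambda>x. 1"]) auto
next
  case (Cons b bs)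
  then obtain P where P: "real_polynomial_function P"
    and eq: "iter_partial bs (\<lambda>x. complex_of_real (exp (- Q x))) = (\<lambda>x. of_real (P x * exp (- Q x)))"
    by blast
  obtain D where D: "\<And>x. (P has_derivative D x) (at x)" "\<And>b. real_polynomial_function (\<lambda>x. D x b)"
    using real_polynomial_function_has_derivative[OF P] by blast
  obtain E where E: "\<And>x. (Q has_derivative E x) (at x)" "\<And>b. real_polynomial_function (\<lambda>x. E x b)"
    using real_polynomial_function_has_derivative[OF assms] by blast
  have "frechet_derivative (\<lambda>x. complex_of_real (P x * exp (- Q x))) (at x) =
          (\<lambda>h. of_real ((D x h - P x * E x h) * exp (- Q x)))" for x
    using frechet_derivative_at[OF has_derivative_times_exp_minus[OF D(1) E(1)]] by simp
  then have "iter_partial (b # bs) (\<lambda>x. complex_of_real (exp (- Q x))) =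
      (\<lambda>x. of_real ((D x b - P x * E x b) * exp (- Q x)))"
    by (simp add: eq)
  moreover have "real_polynomial_function (\<lambda>x. D x b - P x * E x b)"
    by (intro real_polynomial_function_diff real_polynomial_function.intros(4) P D(2) E(2))
  ultimately show ?case by (intro exI[of _ "\<lambda>x. D x b - P x * E x b"] conjI)
qed

text \<open>One term of the exponential series at \<open>1 + t\<close> is at most the whole series.\<close>

lemma power_times_exp_minus_le:
  fixes t :: real
  assumes "0 \<le> 1 + t"
  shows "(1 + t) ^ M * exp (- t) \<le> exp 1 * fact M"
proof -
  have "(\<Sum>n\<in>{M}. (1 + t) ^ n /\<^sub>R fact n) \<le> (\<Sum>n. (1 + t) ^ n /\<^sub>R fact n)"
    using assms by (intro sum_le_suminf summable_exp_generic) auto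
  also have "\<dots> = exp (1 + t)" by (simp add: exp_def)
  finally have "(1 + t) ^ M / fact M \<le> exp (1 + t)" by (simp add: divide_inverse_commute)
  then have "(1 + t) ^ M \<le> fact M * (exp 1 * exp t)"
    by (simp add: field_simps exp_add)
  then have "(1 + t) ^ M * exp (- t) \<le> fact M * (exp 1 * exp t) * exp (- t)"
    by (intro mult_right_mono) auto
  also have "\<dots> = exp 1 * fact M"
    by (simp add: exp_minus)
  finally show ?thesis .
qed

text \<open>The growth hypothesis on \<open>Q\<close> bounds any polynomial in the norm by a multiple of a power of \<open>1 + Q\<close>, and
  such a power is absorbed by \<open>exp (- Q)\<close>.\<close>

lemma schwartz_exp_polynomial:
  fixes Q :: "'a::euclidean_space \<Rightarrow> real"
  assumes Q: "real_polynomial_function Q" and K: "\<And>x. 1 + norm x \<le> K * (1 + Q x)"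
    and pos: "\<And>x. Q x \<ge> 0"
  shows "(\<lambda>x. complex_of_real (exp (- Q x))) \<in> schwartz"
  unfolding schwartz_def mem_Collect_eq
proof (intro allI impI conjI)
  fix bs :: "'a list"
  obtain P where P: "real_polynomial_function P"
    and eq: "iter_partial bs (\<lambda>x. complex_of_real (exp (- Q x))) = (\<lambda>x. of_real (P x * exp (- Q x)))"
    using iter_partial_exp_polynomial[OF Q] by blast
  {
    fix x
    obtain D E where "(P has_derivative D) (at x)" "(Q has_derivative E) (at x)"
      using real_polynomial_function_has_derivative[OF P] real_polynomial_function_has_derivative[OF Q]
      by blast
    then have "(\<lambda>x. complex_of_real (P x * exp (- Q x))) differentiable (at x)"
      unfolding differentiable_def using has_derivative_times_exp_minus by blast
    then show "iter_partial bs (\<lambda>x. complex_of_real (exp (- Q x))) differentiable (at x)"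
      by (simp add: eq)
  }
  fix N :: nat
  obtain C M where C: "C \<ge> 0" "\<And>x. \<bar>P x\<bar> \<le> C * (1 + norm x) ^ M"
    using real_polynomial_function_growth[OF P] by blast
  have "(1 + norm x) ^ N * norm (complex_of_real (P x * exp (- Q x)))
      \<le> C * K ^ (N + M) * (exp 1 * fact (N + M))" for x
  proof -
    have "0 < K * (1 + Q x)" using K[of x] norm_ge_zero[of x] by linarith
    then have "K \<ge> 0" using pos[of x] by (simp add: zero_less_mult_iff)
    have "(1 + norm x) ^ N * norm (complex_of_real (P x * exp (- Q x)))
        = (1 + norm x) ^ N * \<bar>P x\<bar> * exp (- Q x)"
      by (simp add: norm_mult abs_mult)
    also have "\<dots> \<le> (1 + norm x) ^ N * (C * (1 + norm x) ^ M) * exp (- Q x)"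
      by (intro mult_right_mono mult_left_mono C) auto
    also have "\<dots> = C * (1 + norm x) ^ (N + M) * exp (- Q x)"
      by (simp add: power_add mult_ac)
    also have "\<dots> \<le> C * (K * (1 + Q x)) ^ (N + M) * exp (- Q x)"
      by (intro mult_right_mono mult_left_mono power_mono K C) auto
    also have "\<dots> = C * K ^ (N + M) * ((1 + Q x) ^ (N + M) * exp (- Q x))"
      by (simp add: power_mult_distrib mult_ac)
    also have "\<dots> \<le> C * K ^ (N + M) * (exp 1 * fact (N + M))"
      using pos[of x] C(1) \<open>K \<ge> 0\<close> by (intro mult_left_mono power_times_exp_minus_le) auto
    finally show ?thesis .
  qed
  then show "\<exists>C. \<forall>x. (1 + norm x) ^ N * norm (iter_partial bs (\<lambda>x. complex_of_real (exp (- Q x))) x) \<le> C"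
    unfolding eq by blast
qed

section \<open>Integrals of sheared products\<close>

text \<open>Tonelli and translation invariance on each vertical fibre. Both the norm of the test function
  and the size of the set where the maximal function is large are integrals of this form.\<close>

lemma nn_integral_shear:
  fixes F :: "'a::euclidean_space \<Rightarrow> ennreal" and G :: "real \<Rightarrow> ennreal" and \<phi> :: "'a \<Rightarrow> real"
  assumes [measurable]: "F \<in> borel_measurable borel" "G \<in> borel_measurable borel" "\<phi> \<in> borel_measurable borel"
  shows "(\<integral>\<^sup>+v. F (fst v) * G (snd v - \<phi> (fst v)) \<partial>lborel) =
         (\<integral>\<^sup>+w. F w \<partial>lborel) * (\<integral>\<^sup>+s. G s \<partial>lborel)"
proof -
  have "(\<integral>\<^sup>+v. F (fst v) * G (snd v - \<phi> (fst v)) \<partial>lborel) =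
      (\<integral>\<^sup>+v. F (fst v) * G (snd v - \<phi> (fst v)) \<partial>(lborel \<Otimes>\<^sub>M lborel))"
    by (simp add: lborel_prod)
  also have "\<dots> = (\<integral>\<^sup>+w. \<integral>\<^sup>+r. F w * G (r - \<phi> w) \<partial>lborel \<partial>lborel)"
    by (subst lborel.nn_integral_fst[symmetric]) simp_all
  also have "\<dots> = (\<integral>\<^sup>+w. F w * (\<integral>\<^sup>+s. G s \<partial>lborel) \<partial>lborel)"
  proof (intro nn_integral_cong)
    fix w
    have "(\<integral>\<^sup>+r. G (r - \<phi> w) \<partial>lborel) = (\<integral>\<^sup>+s. G s \<partial>lborel)"
      by (subst nn_integral_real_affine[of "\<lambda>r. G (r - \<phi> w)" 1 "\<phi> w"]) simp_all
    then show "(\<integral>\<^sup>+r. F w * G (r - \<phi> w) \<partial>lborel) = F w * (\<integral>\<^sup>+s. G s \<partial>lborel)"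
      by (simp add: nn_integral_cmult)
  qed
  also have "\<dots> = (\<integral>\<^sup>+w. F w \<partial>lborel) * (\<integral>\<^sup>+s. G s \<partial>lborel)"
    by (simp add: nn_integral_multc)
  finally show ?thesis .
qed

text \<open>Up to a factor, the integrand is the normal density of variance \<open>1 / (2 p)\<close>.\<close>

lemma nn_integral_gaussian_real_finite:
  assumes "p > 0"
  shows "(\<integral>\<^sup>+s. ennreal (exp (- p * s\<^sup>2)) \<partial>lborel) < \<infinity>"
proof -
  define \<sigma> where "\<sigma> = 1 / sqrt (2 * p)"
  have \<sigma>: "\<sigma> > 0" "\<sigma>\<^sup>2 = 1 / (2 * p)" using assms by (auto simp: \<sigma>_def power_divide)
  have eq: "exp (- p * s\<^sup>2) = sqrt (2 * pi * \<sigma>\<^sup>2) * normal_density 0 \<sigma> s" for s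
    using \<sigma> assms by (simp add: normal_density_def mult.commute)
  have "integrable lborel (\<lambda>s. exp (- p * s\<^sup>2))"
    unfolding eq using \<sigma>(1) by (intro integrable_mult_right integrable_normal_density)
  then show ?thesis
    by (simp add: integrable_iff_bounded)
qed

lemma nn_integral_gaussian_finite:
  assumes "p > 0"
  shows "(\<integral>\<^sup>+w. ennreal (exp (- p * (norm (w::'a::euclidean_space))\<^sup>2)) \<partial>lborel) < \<infinity>"
proof -
  have "ennreal (exp (- p * (norm w)\<^sup>2)) = (\<Prod>b\<in>Basis. ennreal (exp (- p * (w \<bullet> b)\<^sup>2)))" for w :: 'a
  proof -
    have "(norm w)\<^sup>2 = (\<Sum>b\<in>Basis. (w \<bullet> b)\<^sup>2)"
      unfolding power2_norm_eq_inner by (subst euclidean_inner) (simp add: power2_eq_square)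
    then show ?thesis
      by (simp add: prod_ennreal exp_sum[symmetric] sum_distrib_left sum_negf)
  qed
  then have "(\<integral>\<^sup>+w. ennreal (exp (- p * (norm (w::'a))\<^sup>2)) \<partial>lborel)
      = (\<Prod>b\<in>(Basis::'a set). (\<integral>\<^sup>+s. ennreal (exp (- p * s\<^sup>2)) \<partial>lborel))"
    by (simp add: nn_integral_lborel_prod[where f="\<lambda>b s. ennreal (exp (- p * s\<^sup>2))", simplified])
  also have "\<dots> < \<infinity>"
    using nn_integral_gaussian_real_finite[OF assms]
    by (simp add: power_less_top_ennreal)
  finally show ?thesis .
qed

section \<open>A criterion for unboundedness\<close>

lemma ennreal_powr_ennreal:
  "x \<ge> 0 \<Longrightarrow> ennreal_powr (ennreal x) p = ennreal (x powr p)"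
  by (simp add: ennreal_powr_def)

lemma ennreal_powr_mono:
  assumes "u \<le> v" "p \<ge> 0"
  shows "ennreal_powr u p \<le> ennreal_powr v p"
proof (cases "v = \<infinity>")
  case False
  with assms show ?thesis
    by (auto simp: ennreal_powr_def top_unique less_top intro!: ennreal_leI powr_mono2 enn2real_mono)
qed (simp add: ennreal_powr_def)

text \<open>A bound with constant \<open>C\<close> would force \<open>\<beta> N \<le> C\<^sup>p \<kappa>\<close> for every \<open>N\<close>. The free parameter
  \<open>\<delta>\<close> lets the test functions concentrate as \<open>N\<close> grows.\<close>

lemma not_bounded_on_LpI:
  fixes T :: "('a::euclidean_space \<Rightarrow> complex) \<Rightarrow> 'a \<Rightarrow> ennreal"
  assumes p: "p > 0" and \<kappa>: "\<kappa> \<ge> 0" and \<beta>: "\<beta> > 0"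
    and ex: "\<And>N::nat. \<exists>f\<in>schwartz. \<exists>\<delta>>0.
        (\<integral>\<^sup>+v. ennreal_powr (ennreal (norm (f v))) p \<partial>lborel) \<le> ennreal (\<kappa> * \<delta>) \<and>
        ennreal (\<beta> * real N * \<delta>) \<le> (\<integral>\<^sup>+v. ennreal_powr (T f v) p \<partial>lborel)"
  shows "\<not> bounded_on_Lp p T"
proof
  assume "bounded_on_Lp p T"
  then obtain C where C: "C \<ge> 0"
    "\<And>f. f \<in> schwartz \<Longrightarrow> Lp_norm p (T f) \<le> ennreal C * Lp_norm p (\<lambda>x. ennreal (norm (f x)))"
    unfolding bounded_on_Lp_def by blast
  obtain N :: nat where N: "C powr p * \<kappa> / \<beta> < real N"
    using reals_Archimedean2 by blast
  obtain f \<delta> where f: "f \<in> schwartz" and \<delta>: "\<delta> > 0"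
    and up: "(\<integral>\<^sup>+v. ennreal_powr (ennreal (norm (f v))) p \<partial>lborel) \<le> ennreal (\<kappa> * \<delta>)"
    and low: "ennreal (\<beta> * real N * \<delta>) \<le> (\<integral>\<^sup>+v. ennreal_powr (T f v) p \<partial>lborel)"
    using ex[of N] by blast
  have "ennreal ((\<beta> * real N * \<delta>) powr (1 / p)) = ennreal_powr (ennreal (\<beta> * real N * \<delta>)) (1 / p)"
    using \<beta> \<delta> by (simp add: ennreal_powr_ennreal)
  also have "\<dots> \<le> Lp_norm p (T f)"
    unfolding Lp_norm_def using low p by (intro ennreal_powr_mono) auto
  also have "\<dots> \<le> ennreal C * Lp_norm p (\<lambda>x. ennreal (norm (f x)))"
    by (rule C(2)[OF f])
  also have "\<dots> \<le> ennreal C * ennreal_powr (ennreal (\<kappa> * \<delta>)) (1 / p)"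
    unfolding Lp_norm_def using up p by (intro mult_left_mono ennreal_powr_mono) auto
  also have "\<dots> = ennreal (C * (\<kappa> * \<delta>) powr (1 / p))"
    using \<kappa> \<delta> C(1) by (subst ennreal_powr_ennreal) (simp_all add: ennreal_mult)
  finally have "(\<beta> * real N * \<delta>) powr (1 / p) \<le> C * (\<kappa> * \<delta>) powr (1 / p)"
    using C(1) by simp
  then have "((\<beta> * real N * \<delta>) powr (1 / p)) powr p \<le> (C * (\<kappa> * \<delta>) powr (1 / p)) powr p"
    using p by (intro powr_mono2) auto
  then have "\<beta> * real N * \<delta> \<le> C powr p * (\<kappa> * \<delta>)"
    using p C(1) \<kappa> \<delta> \<beta> by (simp add: powr_mult powr_powr)
  then have "\<beta> * real N \<le> C powr p * \<kappa>"
    using \<delta> by (simp add: mult.assoc[symmetric])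
  with N \<beta> show False by (simp add: field_simps)
qed

section \<open>Averages over the circle\<close>

lemma vector_2_measurable [measurable]:
  "f \<in> borel_measurable M \<Longrightarrow> g \<in> borel_measurable M \<Longrightarrow>
     (\<lambda>x. vector [f x, g x] :: real^2) \<in> borel_measurable M"
proof -
  assume [measurable]: "f \<in> borel_measurable M" "g \<in> borel_measurable M"
  have "(\<lambda>x. vector [f x, g x] :: real^2) = (\<lambda>x. f x *\<^sub>R axis 1 1 + g x *\<^sub>R axis 2 1)"
    by (simp add: fun_eq_iff vec_eq_iff forall_2 axis_def)
  then show ?thesis by simp
qed

lemma vec_nth_measurable [measurable]: "(\<lambda>x::real^2. x $ i) \<in> borel_measurable borel"
  by (intro borel_measurable_continuous_onI continuous_intros)

lemma circle_param_measurable [measurable]: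
  "(\<lambda>\<theta>. vector [cos \<theta>, sin \<theta>] :: real^2) \<in> measurable (restrict_space lborel {0..<2 * pi}) borel"
  by (intro measurable_restrict_space1) measurable

lemma sets_circle_measure [measurable_cong, simp]: "sets circle_measure = sets borel"
  by (simp add: circle_measure_def)

lemma emeasure_circle_measure: "emeasure circle_measure UNIV = ennreal (2 * pi)"
  unfolding circle_measure_def
  by (subst emeasure_distr) (simp_all add: space_restrict_space emeasure_restrict_space)

text \<open>The circle measure lives on all of the plane, so the lower bound \<open>m\<close> is only available almost
  everywhere. The global bound \<open>B\<close> secures integrability, without which the integral would be \<open>0\<close>
  by convention.\<close>

lemma circle_average_ge:
  fixes g :: "real^2 \<Rightarrow> real"
  assumes [measurable]: "g \<in> borel_measurable borel"
    and m: "\<And>y. (y $ 1)\<^sup>2 + (y $ 2)\<^sup>2 = 1 \<Longrightarrow> m \<le> g y" and B: "\<And>y. \<bar>g y\<bar> \<le> B"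
  shows "2 * pi * m \<le> (LINT y|circle_measure. g y)"
proof -
  have sp: "space circle_measure = UNIV" by (simp add: circle_measure_def)
  interpret finite_measure circle_measure
    by standard (simp add: sp emeasure_circle_measure)
  have "AE y in circle_measure. (y $ 1)\<^sup>2 + (y $ 2)\<^sup>2 = (1::real)"
    unfolding circle_measure_def by (subst AE_distr_iff) simp_all
  then have "AE y in circle_measure. m \<le> g y"
    by eventually_elim (rule m)
  then have "(LINT y|circle_measure. m) \<le> (LINT y|circle_measure. g y)"
    by (intro integral_mono_AE integrable_const integrable_const_bound[where B=B]) (auto simp: B)
  then show ?thesis
    by (simp add: sp measure_def emeasure_circle_measure)
qed

section \<open>Gaussians concentrated on a paraboloid\<close>

definition quad_form :: "real \<Rightarrow> real \<Rightarrow> real^2 \<Rightarrow> real" where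
  "quad_form c d w = c * (w $ 1)\<^sup>2 + d * (w $ 2)\<^sup>2"

definition paraboloid_exponent :: "real \<Rightarrow> real \<Rightarrow> real \<Rightarrow> (real^2) \<times> real \<Rightarrow> real" where
  "paraboloid_exponent c d \<delta> v =
     (norm (fst v))\<^sup>2 + ((snd v - quad_form c d (fst v) / 2) / \<delta>)\<^sup>2"

definition paraboloid_gaussian :: "real \<Rightarrow> real \<Rightarrow> real \<Rightarrow> (real^2) \<times> real \<Rightarrow> complex" where
  "paraboloid_gaussian c d \<delta> v = of_real (exp (- paraboloid_exponent c d \<delta> v))"

lemma norm_vec2: "(norm (w::real^2))\<^sup>2 = (w $ 1)\<^sup>2 + (w $ 2)\<^sup>2"
  by (simp add: norm_vec_def L2_set_def sum_2)

lemma quad_form_measurable [measurable]: "quad_form c d \<in> borel_measurable borel"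
  unfolding quad_form_def by measurable

lemma real_polynomial_function_coordinates:
  "real_polynomial_function (\<lambda>v::(real^2) \<times> real. fst v $ i)"
  "real_polynomial_function (\<lambda>v::(real^2) \<times> real. snd v)"
  by (auto intro!: bounded_linear_snd
      bounded_linear_compose[OF bounded_linear_vec_nth bounded_linear_fst])

lemma real_polynomial_paraboloid_exponent:
  "real_polynomial_function (paraboloid_exponent c d \<delta>)"
proof -
  have eq: "paraboloid_exponent c d \<delta> = (\<lambda>v. (fst v $ 1)^2 + (fst v $ 2)^2 +
      ((snd v - (c * (fst v $ 1)^2 + d * (fst v $ 2)^2) / 2) / \<delta>)^2)"
    by (simp add: paraboloid_exponent_def quad_form_def norm_vec2 fun_eq_iff)
  show ?thesis
    unfolding eq
    by (intro real_polynomial_function.intros(2-) real_polynomial_function_power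
        real_polynomial_function_divide real_polynomial_function_diff real_polynomial_function_coordinates)
qed

text \<open>The height is recovered from the exponent as \<open>r = \<delta> u + q(w) / 2\<close>, where \<open>|w|\<^sup>2\<close> and \<open>u\<^sup>2\<close> are the
  two summands; both terms grow at most linearly in the exponent.\<close>

lemma paraboloid_exponent_growth:
  assumes "\<delta> > 0"
  shows "1 + norm v \<le> (2 + \<delta> + \<bar>c\<bar> + \<bar>d\<bar>) * (1 + paraboloid_exponent c d \<delta> v)"
proof -
  define w where "w = fst v"
  define u where "u = (snd v - quad_form c d w / 2) / \<delta>"
  have le: "\<bar>t\<bar> \<le> 1 + t\<^sup>2" for t :: real
    using zero_le_power2[of "\<bar>t\<bar> - 1"] by (simp add: power2_eq_square algebra_simps) 
  have "snd v = \<delta> * u + quad_form c d w / 2" using assms by (simp add: u_def)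
  then have "\<bar>snd v\<bar> \<le> \<delta> * \<bar>u\<bar> + \<bar>quad_form c d w\<bar> / 2"
    using assms abs_triangle_ineq[of "\<delta> * u" "quad_form c d w / 2"] by (simp add: abs_mult)
  moreover have "\<bar>quad_form c d w\<bar> \<le> (\<bar>c\<bar> + \<bar>d\<bar>) * (norm w)\<^sup>2"
  proof -
    have "\<bar>quad_form c d w\<bar> \<le> \<bar>c\<bar> * (w $ 1)\<^sup>2 + \<bar>d\<bar> * (w $ 2)\<^sup>2"
      unfolding quad_form_def by (rule order_trans[OF abs_triangle_ineq]) (simp add: abs_mult)
    also have "\<dots> \<le> \<bar>c\<bar> * (norm w)\<^sup>2 + \<bar>d\<bar> * (norm w)\<^sup>2"
      by (intro add_mono mult_left_mono) (auto simp: norm_vec2)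
    finally show ?thesis by (simp add: algebra_simps)
  qed
  moreover have "\<delta> * \<bar>u\<bar> \<le> \<delta> * (1 + u\<^sup>2)" "norm w \<le> 1 + (norm w)\<^sup>2"
    using assms le[of u] le[of "norm w"] by auto
  moreover have "norm v \<le> norm w + \<bar>snd v\<bar>"
    unfolding w_def using norm_Pair_le[of "fst v" "snd v"] by simp
  ultimately have "1 + norm v \<le> 2 + (norm w)\<^sup>2 + \<delta> * (1 + u\<^sup>2) + (\<bar>c\<bar> + \<bar>d\<bar>) * (norm w)\<^sup>2 / 2"
    by linarith
  also have "\<dots> \<le> (2 + \<delta> + \<bar>c\<bar> + \<bar>d\<bar>) * (1 + ((norm w)\<^sup>2 + u\<^sup>2))"
  proof -
    have "0 \<le> \<delta> * (norm w)\<^sup>2" "0 \<le> (\<bar>c\<bar> + \<bar>d\<bar>) * (norm w)\<^sup>2" "0 \<le> (\<bar>c\<bar> + \<bar>d\<bar>) * u\<^sup>2"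
      using assms by auto
    then show ?thesis
      by (simp add: distrib_left distrib_right)
  qed
  finally show ?thesis by (simp add: paraboloid_exponent_def w_def u_def)
qed

lemma paraboloid_gaussian_schwartz:
  assumes "\<delta> > 0"
  shows "paraboloid_gaussian c d \<delta> \<in> schwartz"
proof -
  have "(\<lambda>v. complex_of_real (exp (- paraboloid_exponent c d \<delta> v))) \<in> schwartz"
    by (rule schwartz_exp_polynomial[OF real_polynomial_paraboloid_exponent paraboloid_exponent_growth[OF assms]])
       (simp add: paraboloid_exponent_def)
  then show ?thesis by (simp add: paraboloid_gaussian_def[abs_def])
qed

text \<open>After the shear the \<open>p\<close>-th power is a product of Gaussians in \<open>w\<close> and in \<open>s / \<delta>\<close>; rescaling
  \<open>s\<close> produces the factor \<open>\<delta>\<close>. That \<open>\<kappa>\<close> depends on \<open>p\<close> alone, and not on \<open>\<delta>\<close>, is essential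
  for the comparison as \<open>\<delta>\<close> tends to \<open>0\<close>.\<close>

lemma paraboloid_gaussian_Lp:
  assumes p: "p > 0"
  shows "\<exists>\<kappa>\<ge>0. \<forall>c d \<delta>. \<delta> > 0 \<longrightarrow>
    (\<integral>\<^sup>+v. ennreal_powr (ennreal (norm (paraboloid_gaussian c d \<delta> v))) p \<partial>lborel) = ennreal (\<kappa> * \<delta>)"
proof -
  define a where "a = (\<integral>\<^sup>+w. ennreal (exp (- p * (norm (w::real^2))\<^sup>2)) \<partial>lborel)"
  define b where "b = (\<integral>\<^sup>+s. ennreal (exp (- p * s\<^sup>2)) \<partial>lborel)"
  have fin: "a < \<infinity>" "b < \<infinity>"
    unfolding a_def b_def by (rule nn_integral_gaussian_finite[OF p] nn_integral_gaussian_real_finite[OF p])+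
  have "(\<integral>\<^sup>+v. ennreal_powr (ennreal (norm (paraboloid_gaussian c d \<delta> v))) p \<partial>lborel)
      = ennreal (enn2real a * enn2real b * \<delta>)" if \<delta>: "\<delta> > 0" for c d \<delta> :: real
  proof -
    have "(\<integral>\<^sup>+v. ennreal_powr (ennreal (norm (paraboloid_gaussian c d \<delta> v))) p \<partial>lborel) =
      (\<integral>\<^sup>+v. ennreal (exp (- p * (norm (fst v))\<^sup>2)) *
          ennreal (exp (- p * ((snd v - quad_form c d (fst v) / 2) / \<delta>)\<^sup>2)) \<partial>lborel)"
    proof (intro nn_integral_cong)
      fix v :: "(real^2) \<times> real"
      show "ennreal_powr (ennreal (norm (paraboloid_gaussian c d \<delta> v))) p =
          ennreal (exp (- p * (norm (fst v))\<^sup>2)) *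
          ennreal (exp (- p * ((snd v - quad_form c d (fst v) / 2) / \<delta>)\<^sup>2))"
        unfolding ennreal_mult'[OF exp_ge_zero, symmetric]
        by (simp add: paraboloid_gaussian_def paraboloid_exponent_def ennreal_powr_ennreal
            powr_def exp_add[symmetric] algebra_simps)
    qed
    also have "\<dots> = a * (\<integral>\<^sup>+s. ennreal (exp (- p * (s / \<delta>)\<^sup>2)) \<partial>lborel)"
      unfolding a_def
      by (rule nn_integral_shear[where \<phi>="\<lambda>w. quad_form c d w / 2" and G="\<lambda>s. ennreal (exp (- p * (s / \<delta>)\<^sup>2))"])
         measurable
    also have "(\<integral>\<^sup>+s. ennreal (exp (- p * (s / \<delta>)\<^sup>2)) \<partial>lborel) = ennreal \<delta> * b"
      using \<delta> unfolding b_def by (subst nn_integral_real_affine[where c=\<delta> and t=0]) simp_all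
    also have "a * (ennreal \<delta> * b) = ennreal (enn2real a * enn2real b * \<delta>)"
      using \<delta> fin by (simp add: ennreal_mult mult_ac)
    finally show ?thesis .
  qed
  then show ?thesis
    by (intro exI[of _ "enn2real a * enn2real b"]) auto
qed

text \<open>The hypothesis \<open>d t\<^sub>2\<^sup>2 = c t\<^sub>1\<^sup>2\<close> says that the quadratic form is constant on the ellipse. Every
  point of integration then has the same sheared height, namely that of \<open>(x, x\<^sub>3)\<close> lowered by
  \<open>c t\<^sub>1\<^sup>2 / 2\<close>, which lies in \<open>[0, \<delta>]\<close>; and its planar part lies within \<open>1 + R\<close> of the origin.\<close>

lemma elliptic_avg_paraboloid_gaussian_ge:
  fixes A :: "real^2^2"
  assumes A: "A = vector [vector [c, 0], vector [0, d]]"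
    and t: "d * t2\<^sup>2 = c * t1\<^sup>2" "\<bar>t1\<bar> \<le> R" "\<bar>t2\<bar> \<le> R"
    and x: "norm x \<le> 1" and \<delta>: "\<delta> > 0"
    and s: "x3 - quad_form c d x / 2 \<in> {c * t1\<^sup>2 / 2 .. c * t1\<^sup>2 / 2 + \<delta>}"
  shows "2 * pi * exp (- ((1 + R)\<^sup>2 + 1)) \<le> norm (elliptic_avg A t1 t2 (paraboloid_gaussian c d \<delta>) (x, x3))"
proof -
  define z :: "real^2 \<Rightarrow> real^2" where "z = (\<lambda>y. vector [t1 * y $ 1, t2 * y $ 2])"
  have z_meas [measurable]: "z \<in> borel_measurable borel" unfolding z_def by measurable
  define g where "g = (\<lambda>y. exp (- paraboloid_exponent c d \<delta> (x - z y, x3 - x \<bullet> (A *v z y))))"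
  have g_meas: "g \<in> borel_measurable borel"
    unfolding g_def paraboloid_exponent_def A
    by (simp add: matrix_vector_mult_def inner_vec_def sum_2) measurable
  have "2 * pi * exp (- ((1 + R)\<^sup>2 + 1)) \<le> (LINT y|circle_measure. g y)"
  proof (rule circle_average_ge[OF g_meas])
    fix y :: "real^2" assume y: "(y $ 1)\<^sup>2 + (y $ 2)\<^sup>2 = 1"
    have R: "R \<ge> 0" using t(2) by linarith
    have "(norm (z y))\<^sup>2 = t1\<^sup>2 * (y $ 1)\<^sup>2 + t2\<^sup>2 * (y $ 2)\<^sup>2"
      by (simp add: norm_vec2 z_def power_mult_distrib)
    also have "\<dots> \<le> R\<^sup>2 * (y $ 1)\<^sup>2 + R\<^sup>2 * (y $ 2)\<^sup>2"
      using t(2,3) R by (intro add_mono mult_right_mono) (auto simp: abs_le_square_iff[symmetric])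
    also have "\<dots> = R\<^sup>2" using y by (simp add: distrib_left[symmetric])
    finally have "norm (z y) \<le> R" using R by (simp add: power2_le_iff_abs_le abs_le_square_iff[symmetric])
    then have "norm (x - z y) \<le> 1 + R"
      using norm_triangle_ineq4[of x "z y"] x by linarith
    then have 1: "(norm (x - z y))\<^sup>2 \<le> (1 + R)\<^sup>2" by (intro power_mono) auto
    have "quad_form c d (z y) = c * t1\<^sup>2 * (y $ 1)\<^sup>2 + (d * t2\<^sup>2) * (y $ 2)\<^sup>2"
      by (simp add: quad_form_def z_def power_mult_distrib)
    also have "\<dots> = c * t1\<^sup>2 * ((y $ 1)\<^sup>2 + (y $ 2)\<^sup>2)"
      by (simp add: t(1) distrib_left)
    finally have qz: "quad_form c d (z y) = c * t1\<^sup>2" using y by simp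
    \<comment> \<open>polarisation: the bilinear twist cancels the cross term of the quadratic form\<close>
    have "x3 - x \<bullet> (A *v z y) - quad_form c d (x - z y) / 2
        = x3 - quad_form c d x / 2 - quad_form c d (z y) / 2"
      unfolding A quad_form_def
      by (simp add: matrix_vector_mult_def inner_vec_def sum_2 power2_eq_square field_simps)
    then have eq: "x3 - x \<bullet> (A *v z y) - quad_form c d (x - z y) / 2 \<in> {0..\<delta>}"
      using s by (simp add: qz)
    have "((x3 - x \<bullet> (A *v z y) - quad_form c d (x - z y) / 2) / \<delta>)\<^sup>2 \<le> 1\<^sup>2"
      using eq \<delta> by (intro power_mono) auto
    with 1 show "exp (- ((1 + R)\<^sup>2 + 1)) \<le> g y"
      by (simp add: g_def paraboloid_exponent_def)
  next
    show "\<bar>g y\<bar> \<le> 1" for y by (simp add: g_def paraboloid_exponent_def)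
  qed
  also have "\<dots> \<le> \<bar>LINT y|circle_measure. g y\<bar>" by simp
  also have "\<dots> = norm (elliptic_avg A t1 t2 (paraboloid_gaussian c d \<delta>) (x, x3))"
    by (simp add: elliptic_avg_def paraboloid_gaussian_def g_def z_def Let_def)
  finally show ?thesis .
qed

section \<open>The extremal heights\<close>

text \<open>Consecutive left end points differ by at least \<open>3 |c| 4\<^bsup>-N\<^esup> / 2\<close>, which exceeds the common length
  \<open>|c| 4\<^bsup>-N\<^esup>\<close>, so the intervals are disjoint.\<close>

lemma emeasure_lacunary_intervals:
  fixes c :: real
  assumes c: "c \<noteq> 0" and \<delta>: "\<delta> = \<bar>c\<bar> * (1/4) ^ N"
  shows "emeasure lborel (\<Union>j\<in>{1..N}. {c * (1/4) ^ j / 2 .. c * (1/4) ^ j / 2 + \<delta>}) = ennreal (real N * \<delta>)"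
proof -
  define I where "I = (\<lambda>j::nat. {c * (1/4) ^ j / 2 .. c * (1/4) ^ j / 2 + \<delta>})"
  have gap: "I i \<inter> I j = {}" if "i < j" "j \<le> N" for i j
  proof -
    have "(1/4::real) ^ N \<le> (1/4) ^ j" using that by (intro power_decreasing) auto
    moreover have "(1/4::real) ^ (Suc i) \<ge> (1/4) ^ j" using that by (intro power_decreasing) auto
    ultimately have "2 * (1/4::real) ^ N < (1/4) ^ i - (1/4) ^ j"
      using zero_less_power[of "1/4::real" N] unfolding power_Suc by linarith
    then have "2 * \<delta> < \<bar>c\<bar> * ((1/4) ^ i - (1/4) ^ j)"
      using c by (simp add: \<delta> mult.left_commute)
    then show ?thesis
      unfolding I_def by (cases "c > 0") (auto simp: algebra_simps abs_if split: if_splits)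
  qed
  have "disjoint_family_on I {1..N}"
    unfolding disjoint_family_on_def
    by (metis gap Int_commute atLeastAtMost_iff nat_neq_iff)
  then have "emeasure lborel (\<Union>j\<in>{1..N}. I j) = (\<Sum>j\<in>{1..N}. emeasure lborel (I j))"
    by (intro sum_emeasure[symmetric]) (auto simp: I_def)
  also have "\<dots> = (\<Sum>j\<in>{1..N}. ennreal \<delta>)"
    by (intro sum.cong) (auto simp: I_def \<delta>)
  also have "\<dots> = ennreal (real N * \<delta>)"
    by (simp add: ennreal_mult' ennreal_of_nat_eq_real_of_nat)
  finally show ?thesis by (simp add: I_def)
qed

text \<open>Arithmetic of the radii \<open>2\<^sup>k\<close> and \<open>2\<^bsup>k - a\<^esup>\<close> at \<open>k = - j\<close>. The second fact makes the quadratic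
  form constant on the ellipse, and the last two bound both radii independently of \<open>j\<close>.\<close>

lemma dyadic_scales:
  "((2::real) powi (- int j))\<^sup>2 = (1/4) ^ j"
  "(2::real) powi (2 * a) * (2 powi (- int j - a))\<^sup>2 = (2 powi (- int j))\<^sup>2"
  "(2::real) powi (- int j) \<le> 1 + 2 powi (- a)"
  "(2::real) powi (- int j - a) \<le> 1 + 2 powi (- a)"
proof -
  have "((2::real) ^ j)\<^sup>2 = 4 ^ j"
    unfolding power_mult[symmetric] using power_mult[of "2::real" 2 j] by (simp add: mult.commute)
  then show "((2::real) powi (- int j))\<^sup>2 = (1/4) ^ j"
    unfolding power_int_minus power_int_of_nat power_inverse power_one_over inverse_eq_divide
    by simp
  have "(2::real) powi (2 * a) = (2 powi a)\<^sup>2"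
    unfolding mult_2 power2_eq_square by (rule power_int_add) simp
  then show "(2::real) powi (2 * a) * (2 powi (- int j - a))\<^sup>2 = (2 powi (- int j))\<^sup>2"
    using power_int_diff[of "2::real" "- int j" a] by (simp add: power_divide)
  have le1: "(2::real) powi (- int j) \<le> 1"
    by (simp add: power_int_minus inverse_le_1_iff)
  have pos: "(2::real) powi (- a) > 0" by simp
  show "(2::real) powi (- int j) \<le> 1 + 2 powi (- a)"
    using le1 pos by linarith
  have "(2::real) powi (- int j - a) = 2 powi (- int j) * 2 powi (- a)"
    using power_int_add[of "2::real" "- int j" "- a"] by simp
  also have "\<dots> \<le> 1 * 2 powi (- a)"
    by (rule mult_right_mono[OF le1]) simp
  finally show "(2::real) powi (- int j - a) \<le> 1 + 2 powi (- a)" by linarith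
qed

text \<open>Stated for any operator dominating the averages over the ellipses with semi-axes \<open>2\<^sup>k\<close> and
  \<open>2\<^bsup>k - a\<^esup>\<close>, so that it applies to both maximal operators.\<close>

lemma not_bounded_on_Lp_of_elliptic_averages:
  fixes A :: "real^2^2" and a :: int
  assumes c: "c \<noteq> 0" and A: "A = vector [vector [c, 0], vector [0, c * 2 powi (2 * a)]]" and p: "p > 0"
    and T: "\<And>k f v. ennreal (norm (elliptic_avg A (2 powi k) (2 powi (k - a)) f v)) \<le> T f v"
  shows "\<not> bounded_on_Lp p T"
proof -
  define d where "d = c * 2 powi (2 * a)"
  define R :: real where "R = 1 + 2 powi (- a)"
  define m where "m = 2 * pi * exp (- ((1 + R)\<^sup>2 + 1))"
  have m: "m > 0" by (simp add: m_def)
  define \<omega> where "\<omega> = measure lborel (cball (0::real^2) 1)"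
  have \<omega>: "\<omega> > 0" "emeasure lborel (cball (0::real^2) 1) = ennreal \<omega>"
    unfolding \<omega>_def using content_cball_pos[of 1 "0::real^2"] emeasure_lborel_cball_finite[of "0::real^2" 1]
    by (auto simp: emeasure_eq_ennreal_measure)
  obtain \<kappa> where \<kappa>: "\<kappa> \<ge> 0" "\<And>c d \<delta>. \<delta> > 0 \<Longrightarrow>
    (\<integral>\<^sup>+v. ennreal_powr (ennreal (norm (paraboloid_gaussian c d \<delta> v))) p \<partial>lborel) = ennreal (\<kappa> * \<delta>)"
    using paraboloid_gaussian_Lp[OF p] by blast
  show ?thesis
  proof (rule not_bounded_on_LpI[OF p \<kappa>(1)])
    show "m powr p * \<omega> > 0" using m \<omega> by simp
    fix N :: nat
    define \<delta> where "\<delta> = \<bar>c\<bar> * (1/4) ^ N"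
    have \<delta>: "\<delta> > 0" using c by (simp add: \<delta>_def)
    define f where "f = paraboloid_gaussian c d \<delta>"
    \<comment> \<open>the sheared heights at which some average among the scales \<open>-1, \<dots>, -N\<close> is large\<close>
    define J where "J = (\<Union>j\<in>{1..N}. {c * (1/4) ^ j / 2 .. c * (1/4) ^ j / 2 + \<delta>})"
    have J: "J \<in> sets borel" unfolding J_def by auto
    have T_ge: "ennreal m \<le> T f (x, x3)"
      if x: "norm x \<le> 1" and x3: "x3 - quad_form c d x / 2 \<in> J" for x x3
    proof -
      obtain j where j: "j \<in> {1..N}"
        "x3 - quad_form c d x / 2 \<in> {c * (1/4) ^ j / 2 .. c * (1/4) ^ j / 2 + \<delta>}"
        using x3 by (auto simp: J_def)
      define k where "k = - int j"
      have "m \<le> norm (elliptic_avg A (2 powi k) (2 powi (k - a)) f (x, x3))"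
        unfolding m_def f_def
      proof (rule elliptic_avg_paraboloid_gaussian_ge[OF A[folded d_def] _ _ _ x \<delta>])
        show "d * (2 powi (k - a))\<^sup>2 = c * (2 powi k)\<^sup>2"
          "\<bar>2 powi k\<bar> \<le> R" "\<bar>2 powi (k - a)\<bar> \<le> R"
          using dyadic_scales(2-4)[where j=j and a=a] by (simp_all add: d_def R_def k_def)
        show "x3 - quad_form c d x / 2 \<in> {c * (2 powi k)\<^sup>2 / 2 .. c * (2 powi k)\<^sup>2 / 2 + \<delta>}"
          using j(2) dyadic_scales(1)[where j=j] by (simp add: k_def)
      qed
      then show ?thesis
        using T[of k f "(x, x3)"] by (meson ennreal_leI order_trans)
    qed
    have "ennreal (m powr p * \<omega> * real N * \<delta>) = ennreal (m powr p) * (ennreal \<omega> * ennreal (real N * \<delta>))"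
      using \<omega>(1) \<delta> by (simp add: ennreal_mult mult_ac)
    also have "\<dots> = (\<integral>\<^sup>+w. ennreal (m powr p) * indicator (cball (0::real^2) 1) w \<partial>lborel) * (\<integral>\<^sup>+s. indicator J s \<partial>lborel)"
      unfolding emeasure_lacunary_intervals[OF c \<delta>_def, folded J_def, symmetric] \<omega>(2)[symmetric]
      by (simp add: nn_integral_cmult_indicator J mult.assoc)
    also have "\<dots> = (\<integral>\<^sup>+v. ennreal (m powr p) * indicator (cball (0::real^2) 1) (fst v) *
        indicator J (snd v - quad_form c d (fst v) / 2) \<partial>lborel)"
      by (rule nn_integral_shear[where F="\<lambda>w. ennreal (m powr p) * indicator (cball 0 1) w"
            and G="indicator J" and \<phi>="\<lambda>w. quad_form c d w / 2", symmetric])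
         (intro borel_measurable_times_ennreal borel_measurable_const borel_measurable_indicator
            borel_measurable_divide quad_form_measurable J borel_closed closed_cball)+
    also have "\<dots> \<le> (\<integral>\<^sup>+v. ennreal_powr (T f v) p \<partial>lborel)"
    proof (intro nn_integral_mono)
      fix v :: "(real^2) \<times> real"
      show "ennreal (m powr p) * indicator (cball 0 1) (fst v) *
          indicator J (snd v - quad_form c d (fst v) / 2) \<le> ennreal_powr (T f v) p"
      proof (cases "norm (fst v) \<le> 1 \<and> snd v - quad_form c d (fst v) / 2 \<in> J")
        case True
        then have "ennreal m \<le> T f v" using T_ge[of "fst v" "snd v"] by simp
        then have "ennreal_powr (ennreal m) p \<le> ennreal_powr (T f v) p"
          using p by (intro ennreal_powr_mono) auto
        with True m show ?thesis by (simp add: ennreal_powr_ennreal indicator_def)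
      qed (auto simp: indicator_def)
    qed
    finally have "ennreal (m powr p * \<omega> * real N * \<delta>) \<le> (\<integral>\<^sup>+v. ennreal_powr (T f v) p \<partial>lborel)" .
    moreover have "f \<in> schwartz" unfolding f_def by (rule paraboloid_gaussian_schwartz[OF \<delta>])
    ultimately show "\<exists>f\<in>schwartz. \<exists>\<delta>>0.
        (\<integral>\<^sup>+v. ennreal_powr (ennreal (norm (f v))) p \<partial>lborel) \<le> ennreal (\<kappa> * \<delta>) \<and>
        ennreal (m powr p * \<omega> * real N * \<delta>) \<le> (\<integral>\<^sup>+v. ennreal_powr (T f v) p \<partial>lborel)"
      using \<delta> \<kappa>(2)[OF \<delta>, of c d] by (intro bexI[of _ f] exI[of _ \<delta>]) (auto simp: f_def)
  qed
qed

theorem theorem1p1: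
  fixes A :: "real^2^2"
  shows "((\<exists>c::real. c \<noteq> 0 \<and> A = c *\<^sub>R mat 1) \<longrightarrow>
            (\<forall>p::real. 0 < p \<longrightarrow> \<not> bounded_on_Lp p (lacunary_circular A))) \<and>
         ((\<exists>(a::int) (c::real). c \<noteq> 0 \<and>
              A = vector [vector [c, 0], vector [0, c * 2 powi (2 * a)]]) \<longrightarrow>
            (\<forall>p::real. 0 < p \<longrightarrow> \<not> bounded_on_Lp p (lacunary_elliptic A)))"
proof (intro conjI impI allI; elim exE conjE)
  fix p c :: real assume "0 < p" "c \<noteq> 0" and A: "A = c *\<^sub>R mat 1"
  have "A = vector [vector [c, 0], vector [0, c * 2 powi (2 * 0)]]"
    by (simp add: A vec_eq_iff forall_2 mat_def)
  with \<open>c \<noteq> 0\<close> show "\<not> bounded_on_Lp p (lacunary_circular A)"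
  proof (rule not_bounded_on_Lp_of_elliptic_averages[OF _ _ \<open>0 < p\<close>])
    fix k f v
    show "ennreal (norm (elliptic_avg A (2 powi k) (2 powi (k - 0)) f v)) \<le> lacunary_circular A f v"
      unfolding lacunary_circular_def diff_0_right by (rule SUP_upper[OF UNIV_I])
  qed
next
  fix p c :: real and a :: int
  assume "0 < p" "c \<noteq> 0" "A = vector [vector [c, 0], vector [0, c * 2 powi (2 * a)]]"
  then show "\<not> bounded_on_Lp p (lacunary_elliptic A)"
  proof (intro not_bounded_on_Lp_of_elliptic_averages)
    fix k f v
    show "ennreal (norm (elliptic_avg A (2 powi k) (2 powi (k - a)) f v)) \<le> lacunary_elliptic A f v"
      unfolding lacunary_elliptic_def by (meson SUP_upper UNIV_I order_trans)
  qed
qed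

end
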